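(* For all integers $m,n\ge 0$ and every $t\in\mathbb{R}$, $$\int_{-\infty}^{+\infty}H_m(y)H_n(y)e^{-y^2-ity}\,dy=(-1)^n\sqrt{\pi}\,(\sqrt{2})^{m+n}e^{-\frac{t^2}{4}}\,H_{m,n}\!\left(-\frac{it}{\sqrt 2},\frac{it}{\sqrt 2}\right).$$
   Context: The real Hermite polynomials are $H_n(x)=(-1)^n e^{x^2}\frac{d^n}{dx^n}(e^{-x^2})$, $n\ge 0$. The complex Hermite polynomials (with two indices) $H_{m,n}(z,\overline z)$, $m,n\ge 0$ integers, $z\in\mathbb{C}$ (with $\overline z$ the complex conjugate of $z$), are defined by the generating function $$\sum_{m,n=0}^{+\infty}\frac{u^m}{m!}\frac{v^n}{n!}H_{m,n}(z,\overline z)=e^{-uv+zu+\overline z v},\qquad u,v\in\mathbb{C}.$$ *)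

theory Defs
  imports "HOL-Complex_Analysis.Complex_Analysis"
begin

definition hermite :: "nat \<Rightarrow> real \<Rightarrow> real" where
  "hermite n x = (-1) ^ n * exp (x\<^sup>2) * (deriv ^^ n) (\<lambda>y. exp (- (y\<^sup>2))) x"

text \<open>
  The double series is an unordered sum over all pairs of indices, so convergence is
  absolute. The two arguments \<open>z\<close> and \<open>w\<close> are those of the customary notation
  $H_{m,n}(z, \overline z)$; the classical polynomials are obtained for \<open>w = cnj z\<close>,
  as in \<open>complex_hermite m n z (cnj z)\<close>.
\<close>

definition complex_hermite_gen :: "complex \<Rightarrow> complex \<Rightarrow> (nat \<Rightarrow> nat \<Rightarrow> complex) \<Rightarrow> bool" where
  "complex_hermite_gen z w c \<longleftrightarrow>
     (\<forall>u v. ((\<lambda>(m, n). u ^ m / fact m * (v ^ n / fact n) * c m n)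
        has_sum exp (- u * v + z * u + w * v)) UNIV)"

definition complex_hermite :: "nat \<Rightarrow> nat \<Rightarrow> complex \<Rightarrow> complex \<Rightarrow> complex" where
  "complex_hermite m n z w = (THE c. complex_hermite_gen z w c) m n"

lemma has_sum_exp: "((\<lambda>k. x ^ k / fact k) has_sum exp x) UNIV" for x :: complex
proof (rule norm_summable_imp_has_sum)
  show "summable (\<lambda>k. norm (x ^ k / fact k))"
    using summable_norm_exp[of x] by (simp add: scaleR_conv_of_real divide_inverse mult.commute norm_mult norm_inverse)
  show "(\<lambda>k. x ^ k / fact k) sums exp x"
    using exp_converges[of x] by (simp add: scaleR_conv_of_real divide_inverse mult.commute)
qed

lemma has_sum_times:
  fixes f :: "'a \<Rightarrow> complex" and g :: "'b \<Rightarrow> complex"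
  assumes f: "(f has_sum a) UNIV" and g: "(g has_sum b) UNIV"
  shows "((\<lambda>(x, y). f x * g y) has_sum a * b) UNIV"
proof -
  have F: "(\<lambda>x. norm (f x)) summable_on UNIV" and G: "(\<lambda>y. norm (g y)) summable_on UNIV"
    using f g by (auto simp flip: summable_on_iff_abs_summable_on_complex simp: summable_on_def)
  have "(\<lambda>p. norm ((\<lambda>(x, y). f x * g y) p)) summable_on Sigma UNIV (\<lambda>_. UNIV)"
    unfolding Infinite_Sum.abs_summable_on_Sigma_iff using F G
    by (auto simp: norm_mult abs_mult infsum_cmult_right' intro!: summable_on_cmult_right summable_on_cmult_left)
  then have "(\<lambda>(x, y). f x * g y) summable_on Sigma UNIV (\<lambda>_. UNIV)"
    by (rule abs_summable_summable)
  then have "((\<lambda>(x, y). f x * g y) has_sum a * b) (Sigma UNIV (\<lambda>_. UNIV))"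
    by (intro has_sum_SigmaI[where g = "\<lambda>x. f x * b"])
       (auto intro!: has_sum_cmult_right has_sum_cmult_left f g)
  then show ?thesis by simp
qed

lemma complex_hermite_gen_exists: "\<exists>c. complex_hermite_gen z w c"
proof -
  define c where "c m n = fact m * fact n * (\<Sum>k\<le>min m n. (-1) ^ k / fact k *
    (z ^ (m - k) / fact (m - k) * (w ^ (n - k) / fact (n - k))))" for m n
  have "((\<lambda>(m, n). u ^ m / fact m * (v ^ n / fact n) * c m n)
        has_sum exp (- u * v + z * u + w * v)) UNIV" for u v
  proof -
    let ?P = "\<lambda>(k, i, j). (- u * v) ^ k / fact k * ((z * u) ^ i / fact i * ((w * v) ^ j / fact j))"
    let ?Q = "\<lambda>((m, n), k). (- u * v) ^ k / fact k * ((z * u) ^ (m - k) / fact (m - k) *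
               ((w * v) ^ (n - k) / fact (n - k)))"
    have "(?P has_sum exp (- u * v) * (exp (z * u) * exp (w * v))) UNIV"
      using has_sum_times[OF has_sum_exp has_sum_times[OF has_sum_exp has_sum_exp]]
      by (simp add: case_prod_unfold)
    also have "?this \<longleftrightarrow> (?Q has_sum exp (- u * v + z * u + w * v))
        (Sigma UNIV (\<lambda>(m, n). {..min m n}))"
      by (rule has_sum_reindex_bij_witness[where j = "\<lambda>(k, i, j). ((i + k, j + k), k)"
            and i = "\<lambda>((m, n), k). (k, m - k, n - k)"]) (auto simp: exp_add[symmetric] algebra_simps)
    finally have "((\<lambda>p. \<Sum>k\<in>(\<lambda>(m, n). {..min m n}) p. ?Q (p, k))
        has_sum exp (- u * v + z * u + w * v)) UNIV"
      by (rule has_sum_SigmaD) (auto intro!: has_sum_finite)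
    moreover have "(\<Sum>k\<in>(\<lambda>(m, n). {..min m n}) p. ?Q (p, k)) =
       (case p of (m, n) \<Rightarrow> u ^ m / fact m * (v ^ n / fact n) * c m n)" for p
    proof -
      obtain m n where p: "p = (m, n)" by (cases p)
      have "(- u * v) ^ k / fact k * ((z * u) ^ (m - k) / fact (m - k) * ((w * v) ^ (n - k) / fact (n - k)))
         = u ^ m * v ^ n * ((-1) ^ k / fact k * (z ^ (m - k) / fact (m - k) * (w ^ (n - k) / fact (n - k))))"
        if "k \<le> min m n" for k
      proof -
        have "u ^ m = u ^ k * u ^ (m - k)" "v ^ n = v ^ k * v ^ (n - k)"
          using that by (simp_all flip: power_add)
        moreover have "(- u * v) ^ k = (-1) ^ k * u ^ k * v ^ k"
          by (simp flip: power_mult_distrib)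
        ultimately show ?thesis by (simp add: power_mult_distrib field_simps)
      qed
      then show ?thesis
        unfolding p c_def
        by (simp add: mult.assoc flip: sum_distrib_left del: times_divide_eq_left times_divide_eq_right)
          (simp add: field_simps)
    qed
    ultimately show ?thesis by simp
  qed
  then show ?thesis unfolding complex_hermite_gen_def by blast
qed

lemma power_series_coeffs_zero:
  fixes a :: "nat \<Rightarrow> complex"
  assumes "\<And>x. ((\<lambda>n. x ^ n / fact n * a n) has_sum 0) UNIV"
  shows "a n = 0"
proof (rule ccontr)
  assume "a n \<noteq> 0"
  have s: "(\<lambda>n. a n / fact n * x ^ n) sums 0" for x
    using has_sum_imp_sums[OF assms[of x]] by (simp add: field_simps)
  have "n \<noteq> 0"
    using s[of 0] \<open>a n \<noteq> 0\<close> unfolding powser_sums_zero_iff by (cases n) auto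
  show False
  proof (rule powser_0_nonzero[of 1 0 "\<lambda>n. a n / fact n" "\<lambda>_. 0" n])
    fix r :: real
    assume "0 < r" and "\<And>x :: complex. x \<in> cball 0 r - {0} \<Longrightarrow> (0 :: complex) \<noteq> 0"
    from this(2)[of "of_real r"] \<open>0 < r\<close> show False by simp
  qed (use s \<open>a n \<noteq> 0\<close> \<open>n \<noteq> 0\<close> in auto)
qed

lemma complex_hermite_gen_unique:
  assumes "complex_hermite_gen z w c" "complex_hermite_gen z w d"
  shows "c = d"
proof -
  define e where "e m n = c m n - d m n" for m n
  have e: "((\<lambda>(m, n). u ^ m / fact m * (v ^ n / fact n) * e m n) has_sum 0) (Sigma UNIV (\<lambda>_. UNIV))" for u v
  proof -
    have "((\<lambda>p. (\<lambda>(m, n). u ^ m / fact m * (v ^ n / fact n) * c m n) p +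
        - (\<lambda>(m, n). u ^ m / fact m * (v ^ n / fact n) * d m n) p) has_sum
        exp (- u * v + z * u + w * v) + - exp (- u * v + z * u + w * v)) UNIV"
      by (intro has_sum_add has_sum_uminusI) (use assms in \<open>auto simp: complex_hermite_gen_def\<close>)
    then show ?thesis by (simp add: case_prod_unfold e_def right_diff_distrib)
  qed
  have row: "(\<lambda>n. v ^ n / fact n * e m n) summable_on UNIV" for v m
  proof -
    have "(\<lambda>n. 1 ^ m / fact m * (v ^ n / fact n) * e m n) summable_on UNIV"
      by (rule summable_on_SigmaD1[where A = UNIV]) (use e[of 1 v] in \<open>auto simp: summable_on_def\<close>)
    from summable_on_cmult_right[OF this, of "fact m"] show ?thesis by simp
  qed
  have "(\<Sum>\<^sub>\<infinity>n. v ^ n / fact n * e m n) = 0" for v m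
  proof (rule power_series_coeffs_zero[where a = "\<lambda>m. \<Sum>\<^sub>\<infinity>n. v ^ n / fact n * e m n"])
    fix u :: complex
    show "((\<lambda>m. u ^ m / fact m * (\<Sum>\<^sub>\<infinity>n. v ^ n / fact n * e m n)) has_sum 0) UNIV"
    proof (rule has_sum_SigmaD[OF e[of u v]])
      fix m :: nat
      show "((\<lambda>n. (\<lambda>(m, n). u ^ m / fact m * (v ^ n / fact n) * e m n) (m, n)) has_sum
          u ^ m / fact m * (\<Sum>\<^sub>\<infinity>n. v ^ n / fact n * e m n)) UNIV"
        using has_sum_cmult_right[OF has_sum_infsum[OF row], of "u ^ m / fact m" v m]
        by (simp only: mult.assoc prod.case)
    qed
  qed
  then have "((\<lambda>n. v ^ n / fact n * e m n) has_sum 0) UNIV" for v m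
    using has_sum_infsum[OF row] by metis
  then have "e m n = 0" for m n
    by (rule power_series_coeffs_zero)
  then show ?thesis by (auto simp: e_def fun_eq_iff)
qed

lemma complex_hermite_generating_function:
  "((\<lambda>(m, n). u ^ m / fact m * (v ^ n / fact n) * complex_hermite m n z w)
     has_sum exp (- u * v + z * u + w * v)) UNIV"
proof -
  have "\<exists>!c. complex_hermite_gen z w c"
    using complex_hermite_gen_exists complex_hermite_gen_unique by blast
  from theI'[OF this] show ?thesis
    by (simp add: complex_hermite_gen_def complex_hermite_def)
qed

end

theory Submission
  imports Defs "HOL-Probability.Probability" "HOL-Real_Asymp.Real_Asymp"
begin

text \<open>
  Both sides satisfy the same recurrence. Let $J_{m,n}$ be the integral. Since
  $H_{m+1} e^{-y^2} = -(H_m e^{-y^2})'$ and $H_n' = 2 n H_{n-1}$, integration by parts gives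
  $J_{m+1,n} = -it J_{m,n} + 2n J_{m,n-1}$. On the other side, the coefficient of $u^m/m!$ in the
  generating function is $e^{wv}(z-v)^m$, and multiplication by $z-v$ gives
  $H_{m+1,n} = z H_{m,n} - n H_{m,n-1}$. The start value $J_{0,0}$ is the characteristic function
  of the normal distribution.
\<close>

section \<open>Real Hermite polynomials as formal polynomials\<close>

fun hermite_poly :: "nat \<Rightarrow> real poly" where
  "hermite_poly 0 = 1"
| "hermite_poly (Suc n) = [:0, 2:] * hermite_poly n - pderiv (hermite_poly n)"

text \<open>Differentiating \<open>p * exp (- x^2)\<close> gives
  \<open>(p' - 2 x p) * exp (- x^2)\<close>, and the recursion of \<open>hermite_poly\<close> is the
  negative of that bracket; each derivative therefore contributes one sign.\<close>

lemma deriv_funpow_gaussian: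
  "(deriv ^^ n) (\<lambda>y :: real. exp (- (y\<^sup>2))) = (\<lambda>x. (-1) ^ n * poly (hermite_poly n) x * exp (- (x\<^sup>2)))"
proof (induction n)
  case (Suc n)
  have "((\<lambda>x. (-1) ^ n * poly (hermite_poly n) x * exp (- (x\<^sup>2))) has_field_derivative
      (-1) ^ Suc n * poly (hermite_poly (Suc n)) x * exp (- (x\<^sup>2))) (at x)" for x
    by (auto intro!: derivative_eq_intros simp: algebra_simps)
  then have "deriv (\<lambda>x. (-1) ^ n * poly (hermite_poly n) x * exp (- (x\<^sup>2))) =
      (\<lambda>x. (-1) ^ Suc n * poly (hermite_poly (Suc n)) x * exp (- (x\<^sup>2)))"
    by (intro ext DERIV_imp_deriv)
  then show ?case by (simp only: funpow.simps comp_apply Suc.IH)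
qed simp

lemma hermite_eq_poly: "hermite n x = poly (hermite_poly n) x"
proof -
  have "hermite n x = ((-1) ^ n * (-1) ^ n) * (exp (x\<^sup>2) * exp (- x\<^sup>2)) * poly (hermite_poly n) x"
    unfolding hermite_def deriv_funpow_gaussian by (simp only: mult_ac)
  then show ?thesis by (simp flip: power_mult_distrib exp_add)
qed

text \<open>Differentiating the recursion for degree n+1 leaves 2 H_n plus 2x H_n' - H_n''. By
  induction the latter is 2n times the recursion that produces H_n from H_(n-1). For
  \<open>n = 0\<close> the truncated index \<open>n - 1\<close> is harmless, since the factor is
  zero.\<close>

lemma pderiv_hermite_poly:
  "pderiv (hermite_poly n) = smult (of_nat (2 * n)) (hermite_poly (n - 1))"
proof (induction n)
  case (Suc n)
  show ?case
  proof (cases n)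
    case 0
    then show ?thesis by (simp add: pderiv_pCons one_pCons)
  next
    case (Suc k)
    have "pderiv (hermite_poly (Suc n)) = smult 2 (hermite_poly n)
        + ([:0, 2:] * pderiv (hermite_poly n) - pderiv (pderiv (hermite_poly n)))"
      by (simp add: pderiv_diff pderiv_mult pderiv_pCons pderiv_smult algebra_simps)
    also have "[:0, 2:] * pderiv (hermite_poly n) - pderiv (pderiv (hermite_poly n))
        = smult (of_nat (2 * n)) (hermite_poly n)"
      unfolding Suc.IH pderiv_smult
      by (simp add: Suc smult_diff_right pderiv_smult)
    finally show ?thesis by (simp add: algebra_simps flip: smult_add_left)
  qed
qed simp

section \<open>Integrability and decay of polynomials times the Gaussian\<close>

lemma poly_gaussian_integrable:
  fixes p :: "real poly"
  shows "integrable lborel (\<lambda>y. poly p y * exp (- (y\<^sup>2)))"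
proof -
  have "integrable lborel (\<lambda>y :: real. y ^ k * exp (- (y\<^sup>2)))" for k
    \<comment> \<open>The normal density with mean 0 and standard deviation
      \<open>1 / sqrt 2\<close> is \<open>exp (- y^2) / sqrt pi\<close>, so monomials reduce to
      normal moments.\<close>
    using integrable_mult_right[OF integrable_normal_moment[of "1 / sqrt 2" 0 k], of "sqrt pi"]
    by (simp add: normal_density_def power_divide real_sqrt_divide mult_ac)
  then show ?thesis
    unfolding poly_altdef sum_distrib_right mult.assoc
    by (intro Bochner_Integration.integrable_sum integrable_mult_right)
qed

lemma poly_gaussian_tendsto_0:
  fixes p :: "real poly"
  shows "((\<lambda>y. poly p y * exp (- (y\<^sup>2))) \<longlongrightarrow> 0) at_top"
    and "((\<lambda>y. poly p y * exp (- (y\<^sup>2))) \<longlongrightarrow> 0) at_bot"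
proof -
  have "((\<lambda>y :: real. y ^ k * exp (- (y\<^sup>2))) \<longlongrightarrow> 0) at_top" for k
    by real_asymp
  then have *: "((\<lambda>y. poly p y * exp (- (y\<^sup>2))) \<longlongrightarrow> 0) at_top" for p :: "real poly"
    unfolding poly_altdef sum_distrib_right mult.assoc
    by (intro tendsto_null_sum tendsto_mult_right_zero)
  then show "((\<lambda>y. poly p y * exp (- (y\<^sup>2))) \<longlongrightarrow> 0) at_top" .
  \<comment> \<open>The Gaussian is even, so reflection reduces this limit to the one at
    \<open>at_top\<close> for p(-y).\<close>
  show "((\<lambda>y. poly p y * exp (- (y\<^sup>2))) \<longlongrightarrow> 0) at_bot"
    using *[of "pcompose p [:0, -1:]"] by (simp add: filterlim_at_bot_mirror poly_pcompose)
qed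

section \<open>Fourier integrals of polynomials against the Gaussian\<close>

definition gauss_wave :: "real \<Rightarrow> real \<Rightarrow> complex" where
  "gauss_wave t y = exp (- (complex_of_real y)\<^sup>2 - \<i> * t * y)"

lemma norm_gauss_wave: "norm (gauss_wave t y) = exp (- (y\<^sup>2))"
  by (simp add: gauss_wave_def)

lemma continuous_on_gauss_wave [continuous_intros]: "continuous_on A (gauss_wave t)"
  unfolding gauss_wave_def by (intro continuous_intros)

lemma poly_gauss_wave_integrable:
  "integrable lborel (\<lambda>y. complex_of_real (poly p y) * gauss_wave t y)"
proof (rule Bochner_Integration.integrable_bound[OF poly_gaussian_integrable[of p]])
  show "(\<lambda>y. complex_of_real (poly p y) * gauss_wave t y) \<in> borel_measurable lborel"
    unfolding measurable_lborel2
    by (intro borel_measurable_continuous_onI continuous_intros)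
qed (simp add: norm_mult norm_gauss_wave abs_mult)

text \<open>Taking the polynomial as the argument turns identities between integrals into linear
  identities between polynomials.\<close>

definition gauss_fourier :: "real \<Rightarrow> real poly \<Rightarrow> complex" where
  "gauss_fourier t p = (LINT y|lborel. complex_of_real (poly p y) * gauss_wave t y)"

lemma gauss_fourier_diff: "gauss_fourier t (p - q) = gauss_fourier t p - gauss_fourier t q"
  using poly_gauss_wave_integrable by (simp add: gauss_fourier_def ring_distribs)

lemma gauss_fourier_smult: "gauss_fourier t (smult c p) = of_real c * gauss_fourier t p"
  by (simp add: gauss_fourier_def mult.assoc)

text \<open>The derivative of \<open>p * gauss_wave t\<close> integrates to zero, because that
  product decays at both ends. The Gaussian contributes -2yp to this derivative and the phase
  contributes -itp.\<close>

lemma gauss_fourier_by_parts: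
  "gauss_fourier t (pderiv p - [:0, 2:] * p) = \<i> * t * gauss_fourier t p"
proof -
  define F where "F y = complex_of_real (poly p y) * gauss_wave t y" for y
  define f where "f y = complex_of_real (poly (pderiv p - [:0, 2:] * p) y) * gauss_wave t y
    - \<i> * t * (complex_of_real (poly p y) * gauss_wave t y)" for y
  have int: "integrable lborel f"
    unfolding f_def by (intro Bochner_Integration.integrable_diff integrable_mult_right poly_gauss_wave_integrable)
  have norm_F: "norm (F y) = \<bar>poly p y * exp (- (y\<^sup>2))\<bar>" for y
    by (simp add: F_def norm_mult norm_gauss_wave abs_mult)
  have lim: "(F \<longlongrightarrow> 0) at_top" "(F \<longlongrightarrow> 0) at_bot"
    by (subst tendsto_norm_zero_iff[symmetric], unfold norm_F,
        rule tendsto_rabs_zero, rule poly_gaussian_tendsto_0)+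
  have "(F has_vector_derivative f y) (at y)" for y
  proof -
    \<comment> \<open>The exponential is differentiated in a complex variable first and then
      restricted to the real line.\<close>
    have "((\<lambda>z. exp (- z\<^sup>2 - \<i> * t * z)) has_field_derivative
        (- (2 * of_real y) - \<i> * t) * gauss_wave t y) (at (complex_of_real y))"
      unfolding gauss_wave_def by (auto intro!: derivative_eq_intros)
    from has_vector_derivative_real_field[OF this]
    have w: "(gauss_wave t has_vector_derivative (- (2 * of_real y) - \<i> * t) * gauss_wave t y) (at y)"
      by (simp add: gauss_wave_def[abs_def] o_def)
    have "((\<lambda>y. complex_of_real (poly p y)) has_vector_derivative of_real (poly (pderiv p) y)) (at y)"
      by (intro has_vector_derivative_of_real) (simp add: poly_DERIV flip: has_real_derivative_iff_has_vector_derivative)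
    from has_vector_derivative_mult[OF this w] show ?thesis
      by (simp add: F_def[abs_def] f_def algebra_simps)
  qed
  moreover have "isCont f y" for y
    by (rule continuous_on_interior[of UNIV]) (auto simp: f_def intro!: continuous_intros)
  ultimately have "(LBINT y=-\<infinity>..\<infinity>. f y) = 0 - 0"
    by (intro interval_integral_FTC_integrable)
       (use int lim in \<open>auto simp: set_integrable_def ereal_tendsto_simps1 ereal_tendsto_simps2\<close>)
  then have "integral\<^sup>L lborel f = 0"
    by (simp add: interval_lebesgue_integral_def set_lebesgue_integral_def)
  moreover have "integral\<^sup>L lborel f =
      gauss_fourier t (pderiv p - [:0, 2:] * p) - \<i> * t * gauss_fourier t p"
    unfolding f_def gauss_fourier_def
    using Bochner_Integration.integral_diff[OF poly_gauss_wave_integrable[of "pderiv p - [:0, 2:] * p" t]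
        integrable_mult_right[of "\<i> * t", OF poly_gauss_wave_integrable[of p t]]]
    unfolding integral_mult_right_zero .
  ultimately show ?thesis by simp
qed

lemma gauss_fourier_1: "gauss_fourier t 1 = of_real (sqrt pi * exp (- (t\<^sup>2 / 4)))"
proof -
  \<comment> \<open>The point \<open>- t / sqrt 2\<close> is chosen so that substituting
    \<open>sqrt 2 * y\<close> for x yields both the weight \<open>exp (- y^2)\<close> and the phase
    -ity.\<close>
  have "complex_of_real (exp (- (t\<^sup>2 / 4))) = char std_normal_distribution (- t / sqrt 2)"
    by (simp add: char_std_normal_distribution power_divide)
  also have "\<dots> = (LINT x|lborel. std_normal_density x *\<^sub>R iexp (- t / sqrt 2 * x))"
    unfolding char_def by (rule integral_density) auto
  also have "\<dots> = sqrt 2 *\<^sub>R (LINT y|lborel. std_normal_density (sqrt 2 * y) *\<^sub>R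
      iexp (- t / sqrt 2 * (sqrt 2 * y)))"
    by (subst lborel_integral_real_affine[where c = "sqrt 2" and t = 0]) auto
  also have "(\<lambda>y. std_normal_density (sqrt 2 * y) *\<^sub>R iexp (- t / sqrt 2 * (sqrt 2 * y))) =
      (\<lambda>y. complex_of_real (1 / sqrt (2 * pi)) * (complex_of_real (poly 1 y) * gauss_wave t y))"
  proof
    fix y :: real
    have "gauss_wave t y = complex_of_real (exp (- (y\<^sup>2))) * exp (- (\<i> * t * y))"
      unfolding gauss_wave_def by (simp add: exp_of_real flip: exp_add exp_of_real)
    then show "std_normal_density (sqrt 2 * y) *\<^sub>R iexp (- t / sqrt 2 * (sqrt 2 * y)) =
        complex_of_real (1 / sqrt (2 * pi)) * (complex_of_real (poly 1 y) * gauss_wave t y)"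
      by (simp add: std_normal_density_def power_mult_distrib scaleR_conv_of_real mult_ac)
  qed
  finally have "complex_of_real (exp (- (t\<^sup>2 / 4))) = of_real (1 / sqrt pi) * gauss_fourier t 1"
    unfolding gauss_fourier_def
    by (simp add: scaleR_conv_of_real real_sqrt_mult)
  then show ?thesis by (simp add: field_simps)
qed

section \<open>Start values and recurrence of the complex Hermite polynomials\<close>

lemma complex_hermite_row:
  "((\<lambda>n. v ^ n / fact n * complex_hermite m n z w) has_sum exp (w * v) * (z - v) ^ m) UNIV"
proof -
  have gen: "((\<lambda>(m, n). u ^ m / fact m * (v ^ n / fact n) * complex_hermite m n z w)
      has_sum exp (- u * v + z * u + w * v)) (Sigma UNIV (\<lambda>_. UNIV))" for u
    using complex_hermite_generating_function by simp
  \<comment> \<open>Setting u = 1 keeps the factor in front of every row nonzero, so it can be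
    cancelled.\<close>
  have "(\<lambda>n. 1 ^ m / fact m * (v ^ n / fact n) * complex_hermite m n z w) summable_on UNIV" for m
    by (rule summable_on_SigmaD1[where A = UNIV]) (use gen[of 1] in \<open>auto simp: summable_on_def\<close>)
  then have row: "(\<lambda>n. v ^ n / fact n * complex_hermite m n z w) summable_on UNIV" for m
    using summable_on_cmult_right[of "\<lambda>n. 1 ^ m / fact m * (v ^ n / fact n) * complex_hermite m n z w" UNIV "fact m"]
    by simp
  define G where "G m = (\<Sum>\<^sub>\<infinity>n. v ^ n / fact n * complex_hermite m n z w)" for m
  \<comment> \<open>For fixed v, both terms have the same exponential generating function in u, so
    their coefficients agree.\<close>
  have "G m - exp (w * v) * (z - v) ^ m = 0"
  proof (rule power_series_coeffs_zero[where a = "\<lambda>m. G m - exp (w * v) * (z - v) ^ m"])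
    fix u :: complex
    have "((\<lambda>m. u ^ m / fact m * G m) has_sum exp (- u * v + z * u + w * v)) UNIV"
    proof (rule has_sum_SigmaD[OF gen])
      fix m :: nat
      show "((\<lambda>n. (\<lambda>(m, n). u ^ m / fact m * (v ^ n / fact n) * complex_hermite m n z w) (m, n))
          has_sum u ^ m / fact m * G m) UNIV"
        using has_sum_cmult_right[OF has_sum_infsum[OF row], of "u ^ m / fact m" m]
        by (simp only: mult.assoc prod.case G_def)
    qed
    moreover have "((\<lambda>m. exp (w * v) * ((u * (z - v)) ^ m / fact m)) has_sum
        exp (w * v) * exp (u * (z - v))) UNIV"
      by (intro has_sum_cmult_right has_sum_exp)
    ultimately have "((\<lambda>m. u ^ m / fact m * G m + - (exp (w * v) * ((u * (z - v)) ^ m / fact m)))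
        has_sum exp (- u * v + z * u + w * v) + - (exp (w * v) * exp (u * (z - v)))) UNIV"
      by (intro has_sum_add has_sum_uminusI)
    also have "exp (- u * v + z * u + w * v) = exp (w * v) * exp (u * (z - v))"
      by (simp add: algebra_simps flip: exp_add)
    finally show "((\<lambda>m. u ^ m / fact m * (G m - exp (w * v) * (z - v) ^ m)) has_sum 0) UNIV"
      unfolding power_mult_distrib by (simp add: right_diff_distrib mult_ac)
  qed
  then show ?thesis
    using has_sum_infsum[OF row[of m]] by (simp add: G_def)
qed

lemma complex_hermite_0: "complex_hermite 0 n z w = w ^ n"
proof -
  have "complex_hermite 0 n z w - w ^ n = 0"
  proof (rule power_series_coeffs_zero[where a = "\<lambda>n. complex_hermite 0 n z w - w ^ n"])
    fix v :: complex
    show "((\<lambda>n. v ^ n / fact n * (complex_hermite 0 n z w - w ^ n)) has_sum 0) UNIV"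
      using has_sum_add[OF complex_hermite_row[of v 0 z w] has_sum_uminusI[OF has_sum_exp[of "w * v"]]]
      by (simp add: power_mult_distrib algebra_simps)
  qed
  then show ?thesis by simp
qed

lemma complex_hermite_Suc:
  "complex_hermite (Suc m) n z w = z * complex_hermite m n z w - of_nat n * complex_hermite m (n - 1) z w"
proof -
  define a where "a n = complex_hermite (Suc m) n z w - z * complex_hermite m n z w
    + of_nat n * complex_hermite m (n - 1) z w" for n
  have "((\<lambda>n. v ^ n / fact n * a n) has_sum 0) UNIV" for v
  proof -
    have not_Suc: "n \<notin> range Suc \<Longrightarrow> n = 0" for n
      by (cases n) auto
    let ?g = "exp (w * v) * (z - v) ^ m"
    \<comment> \<open>Multiplication by v shifts the index: v v^n/n! = (n+1) v^(n+1)/(n+1)!. The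
      index 0 missed by \<open>Suc\<close> contributes nothing because of the factor n.\<close>
    have "((\<lambda>n. v * (v ^ n / fact n * complex_hermite m n z w)) has_sum v * ?g) UNIV"
      by (intro has_sum_cmult_right complex_hermite_row)
    also have "(\<lambda>n. v * (v ^ n / fact n * complex_hermite m n z w)) =
        (\<lambda>n. v ^ n / fact n * (of_nat n * complex_hermite m (n - 1) z w)) \<circ> Suc"
      by (auto simp: fun_eq_iff divide_simps simp del: of_nat_Suc)
    finally have "((\<lambda>n. v ^ n / fact n * (of_nat n * complex_hermite m (n - 1) z w)) has_sum v * ?g) (range Suc)"
      by (subst has_sum_reindex) (simp_all only: inj_Suc)
    also have "?this \<longleftrightarrow> ((\<lambda>n. v ^ n / fact n * (of_nat n * complex_hermite m (n - 1) z w)) has_sum v * ?g) UNIV"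
      by (rule has_sum_cong_neutral) (auto dest: not_Suc)
    finally have shift: "((\<lambda>n. v ^ n / fact n * (of_nat n * complex_hermite m (n - 1) z w)) has_sum v * ?g) UNIV" .
    \<comment> \<open>The three sums cancel, since (z-v) - z + v = 0.\<close>
    have "((\<lambda>n. v ^ n / fact n * complex_hermite (Suc m) n z w
        + - z * (v ^ n / fact n * complex_hermite m n z w)
        + v ^ n / fact n * (of_nat n * complex_hermite m (n - 1) z w)) has_sum
        exp (w * v) * (z - v) ^ Suc m + - z * ?g + v * ?g) UNIV"
      by (intro has_sum_add has_sum_cmult_right complex_hermite_row shift)
    then show ?thesis by (simp add: a_def algebra_simps)
  qed
  then have "a n = 0" by (rule power_series_coeffs_zero)
  then show ?thesis by (simp add: a_def algebra_simps)
qed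

section \<open>Matching the two recurrences\<close>

lemma gauss_fourier_hermite_Suc:
  "gauss_fourier t (hermite_poly (Suc m) * hermite_poly n) =
     - (\<i> * t) * gauss_fourier t (hermite_poly m * hermite_poly n)
     + 2 * of_nat n * gauss_fourier t (hermite_poly m * hermite_poly (n - 1))"
proof -
  let ?P = "hermite_poly m * hermite_poly n"
  \<comment> \<open>The product rule moves the derivative from H_m to H_n; the remainder has exactly
    the form handled by integration by parts.\<close>
  have "hermite_poly (Suc m) * hermite_poly n =
      hermite_poly m * pderiv (hermite_poly n) - (pderiv ?P - [:0, 2:] * ?P)"
    by (simp add: pderiv_mult algebra_simps)
  also have "gauss_fourier t \<dots> = gauss_fourier t (hermite_poly m * pderiv (hermite_poly n))
      - \<i> * t * gauss_fourier t ?P"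
    unfolding gauss_fourier_diff[of t "hermite_poly m * pderiv (hermite_poly n)"]
      gauss_fourier_by_parts ..
  finally show ?thesis
    by (simp add: pderiv_hermite_poly gauss_fourier_smult)
qed

lemma gauss_fourier_hermite:
  "gauss_fourier t (hermite_poly m * hermite_poly n) =
     (-1) ^ n * sqrt pi * sqrt 2 ^ (m + n) * exp (- (t\<^sup>2 / 4))
      * complex_hermite m n (- (\<i> * t / sqrt 2)) (\<i> * t / sqrt 2)"
proof (induction m arbitrary: n)
  case 0
  show ?case
  proof (induction n)
    case 0
    show ?case by (simp add: gauss_fourier_1 complex_hermite_0)
  next
    case (Suc n)
    \<comment> \<open>By symmetry of the product the recurrence applies with the indices exchanged;
      its second term vanishes because the other index is 0.\<close>
    have "gauss_fourier t (hermite_poly 0 * hermite_poly (Suc n)) =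
        - (\<i> * t) * gauss_fourier t (hermite_poly 0 * hermite_poly n)"
      using gauss_fourier_hermite_Suc[of t n 0] by (simp add: mult.commute)
    then show ?case unfolding Suc.IH by (simp add: complex_hermite_0)
  qed
next
  case (Suc m)
  define z s P :: complex where
    "z = - (\<i> * t / sqrt 2)" and "s = sqrt 2" and "P = sqrt pi * exp (- (t\<^sup>2 / 4))"
  note defs = this
  \<comment> \<open>These identities explain the scaling: s is absorbed once by the z term and twice
    by the term with index n-1, whose power of s is one lower. The sign (-1)^n turns its +2n into
    the required -n.\<close>
  have sz: "- (\<i> * t) = s * z" and s2: "2 = s * s"
    by (simp_all add: defs flip: of_real_mult)
  have IH: "gauss_fourier t (hermite_poly m * hermite_poly n) =
      (-1) ^ n * P * s ^ (m + n) * complex_hermite m n z (- z)" for n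
    by (simp add: Suc.IH defs)
  have "gauss_fourier t (hermite_poly (Suc m) * hermite_poly n) =
      (-1) ^ n * P * s ^ (Suc m + n) * complex_hermite (Suc m) n z (- z)"
  proof (cases n)
    case 0
    then show ?thesis
      unfolding gauss_fourier_hermite_Suc IH sz by (simp add: complex_hermite_Suc)
  next
    case (Suc k)
    define a b where "a = complex_hermite m n z (- z)" and "b = complex_hermite m k z (- z)"
    have "gauss_fourier t (hermite_poly (Suc m) * hermite_poly n) =
        s * z * ((-1) ^ n * P * s ^ (m + n) * a) + s * s * of_nat n * ((-1) ^ k * P * s ^ (m + k) * b)"
      unfolding gauss_fourier_hermite_Suc IH sz s2 by (simp only: Suc diff_Suc_1 a_def b_def)
    also have "\<dots> = (-1) ^ n * P * s ^ (Suc m + n) * (z * a - of_nat n * b)"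
      unfolding right_diff_distrib by (simp add: Suc mult_ac del: of_nat_Suc)
    finally show ?thesis by (simp add: complex_hermite_Suc a_def b_def Suc)
  qed
  then show ?case unfolding defs by simp
qed

theorem corollary4p2:
  fixes m n :: nat and t :: real
  shows "has_bochner_integral lborel
    (\<lambda>y. complex_of_real (hermite m y * hermite n y) * exp (- (complex_of_real y)\<^sup>2 - \<i> * t * y))
    ((-1) ^ n * sqrt pi * sqrt 2 ^ (m + n) * exp (- (t\<^sup>2 / 4))
      * complex_hermite m n (- (\<i> * t / sqrt 2)) (\<i> * t / sqrt 2))"
  using has_bochner_integral_integrable[OF poly_gauss_wave_integrable[of "hermite_poly m * hermite_poly n" t]]
  unfolding gauss_fourier_def[symmetric] gauss_fourier_hermite
  by (simp add: hermite_eq_poly gauss_wave_def)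

end
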